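(* Let $G$ be a finite, simple, connected graph. \begin{enumerate} \item If $G$ is the path graph of length $M$, then $G$ is circularly $k$-partite for each $k\in\{1,\ldots,2M\}$. \item If $G$ is an extended star graph of diameter $M$, then $G$ is circularly $k$-partite for each $k\in\{1,\ldots,M\}$. \item Suppose $G$ is neither a path graph nor an extended star graph, and let $k\geq 1$. Then $G$ is circularly $k$-partite if and only if both of the following hold: (i) the length of every cycle of $G$ is a multiple of $k$; and (ii) for every path in $G$ connecting two distinct vertices of degree $\geq 3$, its length $\ell$ is such that $2\ell$ is a multiple of $k$. \end{enumerate}
   Context: All graphs are finite, simple (undirected, unweighted, no loops, no multi-edges) and connected. A path of length $\ell\geq1$ is a sequence $v_1,\ldots,v_{\ell+1}$ of distinct vertices with $v_j\sim v_{j+1}$ for all $j$; a cycle of length $\ell\geq 3$ is a sequence $v_1,\ldots,v_{\ell+1}$ with $v_{\ell+1}=v_1$, $v_1,\dots,v_\ell$ distinct and $v_j\sim v_{j+1}$. The path graph of length $M$ is the graph consisting of a single path of length $M$. An oriented edge $[v,w]$ is an edge $\{v,w\}$ with input $v$ and output $w$; $\mathcal{O}=\{[v,w],[w,v]: v\sim w\}$ is the set of oriented edges. For $k\geq 1$, $G$ is circularly $k$-partite if $\mathcal{O}$ can be partitioned as $\mathcal{O}=\mathcal{O}_1\sqcup\cdots\sqcup\mathcal{O}_k$ with all $\mathcal{O}_j$ non-empty and such that $[v,w]\in\mathcal{O}_j$ implies $[w,z]\in\mathcal{O}_{j+1}$ for every $z\sim w$ with $z\neq v$, indices taken modulo $k$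 (so $\mathcal{O}_{k+1}=\mathcal{O}_1$). An extended star graph is a tree with exactly one vertex of degree $\geq 3$. The diameter of a graph is the maximum, over pairs of vertices, of the length of a shortest path between them.
   Formalization: Part 3 additionally assumes that G has at least one edge; the one-vertex graph is excluded, since for it (i) and (ii) hold vacuously while the empty set of oriented edges has no partition into k non-empty classes. *)

theory Defs
  imports "Graph_Theory.Graph_Theory" "HOL-Library.Disjoint_Sets"
begin

text \<open>
  A finite simple graph is a \<^locale>\<open>pair_graph\<close>, i.e. a finite, loopfree, symmetric digraph
  whose arcs are pairs of vertices. Each undirected edge is represented by its two
  orientations, so \<^term>\<open>parcs G\<close> is exactly the set of oriented edges of \<^term>\<open>G\<close>.
  The length of a vertex sequence is \<^const>\<open>vwalk_length\<close>, the number of its steps.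
\<close>

text \<open>The number of neighbours, since the digraph is symmetric and has no parallel arcs.\<close>
definition vdegree :: "'a pair_pre_digraph \<Rightarrow> 'a \<Rightarrow> nat" where
  "vdegree G v = out_degree (with_proj G) v"

text \<open>Unlike \<^const>\<open>vpath\<close>, this excludes the one-vertex sequence of length 0.\<close>
definition is_path :: "'a pair_pre_digraph \<Rightarrow> 'a list \<Rightarrow> bool" where
  "is_path G p \<longleftrightarrow> vpath p (with_proj G) \<and> 1 \<le> vwalk_length p"

text \<open>
  The library's \<open>pre_digraph.cycle\<close> (and hence \<^const>\<open>tree\<close>) is not suitable here, since it counts
  a pair of opposite arcs as a cycle of length 2.
\<close>
definition is_cycle :: "'a pair_pre_digraph \<Rightarrow> 'a list \<Rightarrow> bool" where
  "is_cycle G c \<longleftrightarrow> vwalk c (with_proj G) \<and> 3 \<le> vwalk_length c \<and>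
     last c = hd c \<and> distinct (butlast c)"

definition is_path_graph :: "'a pair_pre_digraph \<Rightarrow> nat \<Rightarrow> bool" where
  "is_path_graph G M \<longleftrightarrow> (\<exists>p. is_path G p \<and> vwalk_length p = M \<and>
     pverts G = set p \<and> parcs G = set (vwalk_arcs p) \<union> (set (vwalk_arcs p))\<inverse>)"

definition is_tree :: "'a pair_pre_digraph \<Rightarrow> bool" where
  "is_tree G \<longleftrightarrow> connected (with_proj G) \<and> \<not> (\<exists>c. is_cycle G c)"

definition is_extended_star :: "'a pair_pre_digraph \<Rightarrow> bool" where
  "is_extended_star G \<longleftrightarrow> is_tree G \<and> (\<exists>!v. v \<in> pverts G \<and> 3 \<le> vdegree G v)"

text \<open>\<^const>\<open>vpath\<close> rather than \<^const>\<open>is_path\<close>, so that a vertex has distance 0 to itself.\<close>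
definition vdist :: "'a pair_pre_digraph \<Rightarrow> 'a \<Rightarrow> 'a \<Rightarrow> nat" where
  "vdist G u v = (LEAST n. \<exists>p. vpath p (with_proj G) \<and> hd p = u \<and> last p = v \<and> vwalk_length p = n)"

definition diameter :: "'a pair_pre_digraph \<Rightarrow> nat" where
  "diameter G = Max {vdist G u v | u v. u \<in> pverts G \<and> v \<in> pverts G}"

text \<open>The classes are indexed by 1, ..., k; the cyclic successor of the index j is \<open>j mod k + 1\<close>.\<close>
definition circularly_partite :: "nat \<Rightarrow> 'a pair_pre_digraph \<Rightarrow> bool" where
  "circularly_partite k G \<longleftrightarrow> 1 \<le> k \<and>
     (\<exists>Q :: nat \<Rightarrow> ('a \<times> 'a) set.
        parcs G = (\<Union>j\<in>{1..k}. Q j) \<and> disjoint_family_on Q {1..k} \<and>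
        (\<forall>j\<in>{1..k}. Q j \<noteq> {}) \<and>
        (\<forall>j\<in>{1..k}. \<forall>v w. (v, w) \<in> Q j \<longrightarrow>
           (\<forall>z. (w, z) \<in> parcs G \<and> z \<noteq> v \<longrightarrow> (w, z) \<in> Q (j mod k + 1))))"

end

theory Submission
  imports Defs
begin

text \<open>
  A partition into \<open>k\<close> classes is a labelling of the oriented edges modulo \<open>k\<close> that increases by 1
  along every non-backtracking step. Following it around a cycle, or along a path between two
  branch vertices and back, gives the divisibility conditions. Conversely, take a root \<open>r\<close>, a
  branch vertex if there is one, and let \<open>d\<close> be the distance from \<open>r\<close>. Label \<open>(u, w)\<close> by \<open>- d u\<close>
  if it leads closer to \<open>r\<close> and by \<open>d u\<close> otherwise. A step can violate the rule only at a branch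
  vertex \<open>w \<noteq> r\<close>, which needs \<open>k dvd 2 * d w\<close>, or where two geodesics from \<open>r\<close> meet, and there the
  defect is the length of a cycle plus twice the distance from \<open>r\<close> to the vertex where the
  geodesics separate. The labels \<open>-a, ..., a - 1\<close> occur as soon as some vertex has distance \<open>a\<close>
  from \<open>r\<close>, and a cycle meets all residues modulo \<open>k\<close>.
\<close>

section \<open>Walks and distances\<close>

lemma set_vwalk_arcs_nth:
  "set (vwalk_arcs p) = {(p ! i, p ! Suc i) | i. Suc i < length p}"
proof (induct p rule: vwalk_arcs.induct)
  case (3 x y xs)
  have "{((x # y # xs) ! i, (x # y # xs) ! Suc i) | i. Suc i < length (x # y # xs)} =
    insert (x, y) {((y # xs) ! i, (y # xs) ! Suc i) | i. Suc i < length (y # xs)}"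
    (is "?L = ?R")
  proof
    show "?L \<subseteq> ?R"
    proof
      fix e assume "e \<in> ?L"
      then obtain i where i: "e = ((x # y # xs) ! i, (x # y # xs) ! Suc i)"
        "Suc i < length (x # y # xs)" by blast
      then show "e \<in> ?R" by (cases i) auto
    qed
    show "?R \<subseteq> ?L"
    proof
      fix e assume "e \<in> ?R"
      then consider "e = (x, y)" | i where "e = ((y # xs) ! i, (y # xs) ! Suc i)"
        "Suc i < length (y # xs)" by blast
      then show "e \<in> ?L"
      proof cases
        case 1
        then show ?thesis by (intro CollectI exI[of _ 0]) auto
      next
        case (2 i)
        then show ?thesis by (intro CollectI exI[of _ "Suc i"]) auto
      qed
    qed
  qed
  then show ?case using 3 by simp
qed simp_all

lemma length_vwalk_to_vpath: "length (vwalk_to_vpath p) \<le> length p"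
proof (induct p rule: vwalk_to_vpath_induct3)
  case (in_set x xs)
  then show ?case
    using length_dropWhile_le[of "\<lambda>y. y \<noteq> x" xs] by simp
qed simp_all

context pair_graph
begin

lemma arc_sym: "(u, v) \<in> parcs G \<Longrightarrow> (v, u) \<in> parcs G"
  by (rule arcs_symmetric)

lemma arc_neq: "(u, v) \<in> parcs G \<Longrightarrow> u \<noteq> v"
  using pair_no_loops by fastforce

lemma vwalk_iff_nth:
  "vwalk p (with_proj G) \<longleftrightarrow> p \<noteq> [] \<and> set p \<subseteq> pverts G \<and>
     (\<forall>i. Suc i < length p \<longrightarrow> (p ! i, p ! Suc i) \<in> parcs G)"
  unfolding vwalk_def set_vwalk_arcs_nth by auto

lemma vwalk_arc_nth:
  "vwalk p (with_proj G) \<Longrightarrow> Suc i < length p \<Longrightarrow> (p ! i, p ! Suc i) \<in> parcs G"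
  by (simp add: vwalk_iff_nth)

lemma vwalk_ConsI:
  "vwalk p (with_proj G) \<Longrightarrow> (a, hd p) \<in> parcs G \<Longrightarrow> vwalk (a # p) (with_proj G)"
  by (rule vwalk_wf_digraph_consI) simp_all

lemma vwalk_appendI:
  assumes "vwalk p (with_proj G)" "vwalk q (with_proj G)" "(last p, hd q) \<in> parcs G"
  shows "vwalk (p @ q) (with_proj G)"
proof -
  have "p \<noteq> []" "q \<noteq> []" using assms by (auto simp: vwalk_def)
  then show ?thesis using assms by (auto simp: vwalk_def vwalk_arcs_append)
qed

lemma vwalk_snocI:
  "vwalk p (with_proj G) \<Longrightarrow> (last p, a) \<in> parcs G \<Longrightarrow> vwalk (p @ [a]) (with_proj G)"
  by (rule vwalk_appendI) (auto intro: in_arcsD2)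

lemma vwalk_rev:
  "vwalk p (with_proj G) \<Longrightarrow> vwalk (rev p) (with_proj G)"
  by (auto simp: vwalk_def set_vwalk_arcs_rev intro: arc_sym)

text \<open>Cutting the loops out of a walk leaves a path that is no longer, so walks with repeated
  vertices may be used to bound distances.\<close>

lemma vdist_le_vwalk:
  assumes "vwalk p (with_proj G)"
  shows "vdist G (hd p) (last p) \<le> length p - 1"
proof -
  let ?q = "vwalk_to_vpath p"
  have "vdist G (hd p) (last p) \<le> vwalk_length ?q"
    unfolding vdist_def
    by (rule Least_le)
      (use vwalk_to_vpath_vpath[OF assms] vwalk_to_vpath_hd vwalk_to_vpath_last in blast)
  then show ?thesis using length_vwalk_to_vpath[of p] by simp
qed

lemma finite_neighbours: "finite {w. (v, w) \<in> parcs G}"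
proof -
  have "{w. (v, w) \<in> parcs G} \<subseteq> pverts G" by (auto dest: in_arcsD2)
  then show ?thesis using pair_finite_verts finite_subset by blast
qed

lemma vdegree_eq_card: "vdegree G v = card {w. (v, w) \<in> parcs G}"
proof -
  have "out_arcs (with_proj G) v = Pair v ` {w. (v, w) \<in> parcs G}"
    by (auto simp: out_arcs_def)
  then show ?thesis
    unfolding vdegree_def out_degree_def by (simp add: card_image inj_on_def)
qed

lemma vdegree_ge_3I:
  assumes "(v, a) \<in> parcs G" "(v, b) \<in> parcs G" "(v, c) \<in> parcs G" "a \<noteq> b" "a \<noteq> c" "b \<noteq> c"
  shows "3 \<le> vdegree G v"
proof -
  have "card {a, b, c} \<le> card {w. (v, w) \<in> parcs G}"
    using assms by (intro card_mono finite_neighbours) auto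
  then show ?thesis using assms by (simp add: vdegree_eq_card)
qed

lemma vdegree_ge_3E:
  assumes "3 \<le> vdegree G v"
  obtains x y where "(v, x) \<in> parcs G" "(v, y) \<in> parcs G" "x \<noteq> y" "x \<noteq> a" "y \<noteq> a"
proof -
  have "2 \<le> card ({w. (v, w) \<in> parcs G} - {a})"
    using assms card_Diff_singleton_if[of "{w. (v, w) \<in> parcs G}" a]
    by (auto simp: vdegree_eq_card split: if_splits)
  then obtain B where B: "B \<subseteq> {w. (v, w) \<in> parcs G} - {a}" "card B = 2"
    using obtain_subset_with_card_n by metis
  then obtain x y where "B = {x, y}" "x \<noteq> y" by (auto simp: card_2_iff)
  then show ?thesis using B that by blast
qed

end

section \<open>Labellings of the oriented edges\<close>

text \<open>Labels are integers compared only modulo \<open>k\<close>, so they may be negative and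
  congruences along a walk can be added. That every residue occurs is a separate matter.\<close>

definition circular_labelling :: "nat \<Rightarrow> 'a pair_pre_digraph \<Rightarrow> ('a \<times> 'a \<Rightarrow> int) \<Rightarrow> bool" where
  "circular_labelling k G f \<longleftrightarrow> (\<forall>u w z. (u, w) \<in> parcs G \<longrightarrow> (w, z) \<in> parcs G \<longrightarrow> u \<noteq> z \<longrightarrow>
     int k dvd f (w, z) - f (u, w) - 1)"

lemma circularly_partiteI:
  assumes k: "1 \<le> k" and f: "circular_labelling k G f"
    and onto: "\<And>j. j < k \<Longrightarrow> \<exists>e\<in>parcs G. int k dvd f e - int j"
  shows "circularly_partite k G"
proof -
  \<comment> \<open>Classes are numbered from 1 and residues from 0, so class \<open>j\<close>
    carries the residue \<open>j - 1\<close>, and its successor \<open>j mod k + 1\<close> carries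
    \<open>j mod k\<close>.\<close>
  define Q where "Q j = {e \<in> parcs G. f e mod int k = int j - 1}" for j
  have Un: "parcs G = (\<Union>j\<in>{1..k}. Q j)"
  proof
    show "parcs G \<subseteq> (\<Union>j\<in>{1..k}. Q j)"
    proof
      fix e assume e: "e \<in> parcs G"
      have r: "0 \<le> f e mod int k" "f e mod int k < int k" using k by auto
      let ?j = "nat (f e mod int k) + 1"
      have "?j \<in> {1..k}" using r by auto
      moreover have "e \<in> Q ?j" using e r by (simp add: Q_def)
      ultimately show "e \<in> (\<Union>j\<in>{1..k}. Q j)" by blast
    qed
  qed (auto simp: Q_def)
  have disj: "disjoint_family_on Q {1..k}"
    by (auto simp: disjoint_family_on_def Q_def)
  have ne: "\<forall>j\<in>{1..k}. Q j \<noteq> {}"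
  proof
    fix j assume j: "j \<in> {1..k}"
    then have "j - 1 < k" by auto
    then obtain e where e: "e \<in> parcs G" "int k dvd f e - int (j - 1)"
      using onto by blast
    then have "f e mod int k = int (j - 1) mod int k" by (simp add: mod_eq_dvd_iff)
    then have "e \<in> Q j" using e(1) j by (simp add: Q_def of_nat_diff)
    then show "Q j \<noteq> {}" by blast
  qed
  have step: "(w, z) \<in> Q (j mod k + 1)"
    if j: "j \<in> {1..k}" and vw: "(v, w) \<in> Q j" and wz: "(w, z) \<in> parcs G" "z \<noteq> v" for j v w z
  proof -
    have "int k dvd f (w, z) - (f (v, w) + 1)"
      using f vw wz by (auto simp: circular_labelling_def Q_def algebra_simps)
    then have "f (w, z) mod int k = (f (v, w) + 1) mod int k" by (simp add: mod_eq_dvd_iff)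
    also have "\<dots> = (f (v, w) mod int k + 1) mod int k" by (simp add: mod_add_left_eq)
    also have "\<dots> = int (j mod k)" using vw by (simp add: Q_def zmod_int)
    finally show ?thesis using wz by (simp add: Q_def)
  qed
  show ?thesis
    unfolding circularly_partite_def using k Un disj ne step by blast
qed

lemma circularly_partite_labelling:
  assumes "circularly_partite k G"
  obtains f where "circular_labelling k G f"
proof -
  obtain Q where k: "1 \<le> k" and Un: "parcs G = (\<Union>j\<in>{1..k}. Q j)"
    and disj: "disjoint_family_on Q {1..k}"
    and step: "\<And>j v w z. j \<in> {1..k} \<Longrightarrow> (v, w) \<in> Q j \<Longrightarrow> (w, z) \<in> parcs G \<Longrightarrow> z \<noteq> v \<Longrightarrow>
      (w, z) \<in> Q (j mod k + 1)"
    using assms unfolding circularly_partite_def by metis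
  define g where "g e = (SOME j. j \<in> {1..k} \<and> e \<in> Q j)" for e
  have g: "g e \<in> {1..k} \<and> e \<in> Q (g e)" if "e \<in> parcs G" for e
    unfolding g_def by (rule someI_ex) (use that Un in blast)
  have uniq: "i = j" if "i \<in> {1..k}" "j \<in> {1..k}" "e \<in> Q i" "e \<in> Q j" for i j e
    using disj that unfolding disjoint_family_on_def by blast
  have "circular_labelling k G (\<lambda>e. int (g e))"
    unfolding circular_labelling_def
  proof (intro allI impI)
    fix u w z assume a: "(u, w) \<in> parcs G" "(w, z) \<in> parcs G" "u \<noteq> z"
    have m: "g (u, w) mod k + 1 \<in> {1..k}" using k by (auto simp: Suc_le_eq)
    have "(w, z) \<in> Q (g (u, w) mod k + 1)" using step g[OF a(1)] a by blast
    then have "g (w, z) = g (u, w) mod k + 1" using uniq g[OF a(2)] m by blast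
    then show "int k dvd int (g (w, z)) - int (g (u, w)) - 1"
      by (simp add: zmod_int mod_eq_dvd_iff[symmetric])
  qed
  then show ?thesis using that by blast
qed

lemma circular_labelling_step:
  "circular_labelling k G f \<Longrightarrow> (u, w) \<in> parcs G \<Longrightarrow> (w, z) \<in> parcs G \<Longrightarrow> u \<noteq> z \<Longrightarrow>
    int k dvd f (w, z) - f (u, w) - 1"
  by (auto simp: circular_labelling_def)

section \<open>Labels along walks, around cycles and between branch vertices\<close>

context pair_graph
begin

text \<open>Summing the step rule telescopes. Premise \<open>nb\<close> forbids turning back, the
  one situation on which the rule says nothing.\<close>

lemma labelling_along_walk:
  assumes f: "circular_labelling k G f" and p: "vwalk p (with_proj G)"
    and nb: "\<And>i. Suc (Suc i) < length p \<Longrightarrow> p ! i \<noteq> p ! Suc (Suc i)"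
  shows "Suc i < length p \<Longrightarrow> int k dvd f (p ! i, p ! Suc i) - f (p ! 0, p ! Suc 0) - int i"
proof (induct i)
  case (Suc i)
  have "int k dvd f (p ! Suc i, p ! Suc (Suc i)) - f (p ! i, p ! Suc i) - 1"
    using Suc.prems by (intro circular_labelling_step[OF f] vwalk_arc_nth[OF p] nb) auto
  moreover have "int k dvd f (p ! i, p ! Suc i) - f (p ! 0, p ! Suc 0) - int i"
    using Suc by simp
  ultimately have "int k dvd (f (p ! Suc i, p ! Suc (Suc i)) - f (p ! i, p ! Suc i) - 1) +
      (f (p ! i, p ! Suc i) - f (p ! 0, p ! Suc 0) - int i)"
    by (rule dvd_add)
  then show ?case by (simp add: algebra_simps)
qed simp

lemma cycle_nth:
  assumes "is_cycle G c"
  obtains L where "3 \<le> L" "length c = Suc L" "vwalk c (with_proj G)" "vwalk_length c = L"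
    "c ! L = c ! 0" "\<And>i j. i < L \<Longrightarrow> j < L \<Longrightarrow> c ! i = c ! j \<longleftrightarrow> i = j"
proof -
  let ?L = "length c - 1"
  have c: "vwalk c (with_proj G)" "3 \<le> ?L" "last c = hd c" "distinct (butlast c)"
    using assms by (auto simp: is_cycle_def)
  have ne: "c \<noteq> []" using c(1) by auto
  have "c ! ?L = c ! 0" using c(3) ne by (simp add: last_conv_nth hd_conv_nth)
  moreover have "c ! i = c ! j \<longleftrightarrow> i = j" if "i < ?L" "j < ?L" for i j
    using nth_eq_iff_index_eq[OF c(4)] that by (simp add: nth_butlast)
  ultimately show ?thesis using that[of ?L] c by (simp add: Suc_diff_Suc ne)
qed

lemma labelling_along_cycle:
  assumes f: "circular_labelling k G f" and c: "is_cycle G c" and i: "i < vwalk_length c"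
  shows "int k dvd f (c ! i, c ! Suc i) - f (c ! 0, c ! Suc 0) - int i"
proof -
  obtain L where L: "3 \<le> L" "length c = Suc L" "vwalk c (with_proj G)" "vwalk_length c = L"
    "c ! L = c ! 0" "\<And>i j. i < L \<Longrightarrow> j < L \<Longrightarrow> c ! i = c ! j \<longleftrightarrow> i = j"
    by (rule cycle_nth[OF c]) blast
  \<comment> \<open>A cycle has at least three vertices, so moving two places never returns to the
    start, even when the second place is \<open>L\<close>, which repeats position 0.\<close>
  have "c ! i \<noteq> c ! Suc (Suc i)" if "Suc (Suc i) < length c" for i
  proof (cases "Suc (Suc i) = L")
    case True
    then show ?thesis using L(6)[of i 0] L(1,5) by auto
  next
    case False
    then show ?thesis using L(6)[of i "Suc (Suc i)"] L(2) that by auto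
  qed
  then show ?thesis
    using labelling_along_walk[OF f L(3)] i L by simp
qed

text \<open>One full turn adds 1 for each of the \<open>L\<close> arcs and ends at the label it
  began with. Following the sequence supplies \<open>L - 1\<close> of these steps; the one from the
  last arc to the first is added separately.\<close>

lemma labelling_cycle_dvd:
  assumes f: "circular_labelling k G f" and c: "is_cycle G c"
  shows "k dvd vwalk_length c"
proof -
  obtain L where L: "3 \<le> L" "length c = Suc L" "vwalk c (with_proj G)" "vwalk_length c = L"
    "c ! L = c ! 0" "\<And>i j. i < L \<Longrightarrow> j < L \<Longrightarrow> c ! i = c ! j \<longleftrightarrow> i = j"
    by (rule cycle_nth[OF c]) blast
  obtain m where m: "L = Suc m" using L(1) by (cases L) auto
  have "int k dvd f (c ! m, c ! Suc m) - f (c ! 0, c ! Suc 0) - int m"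
    using labelling_along_cycle[OF f c] L(4) m by simp
  moreover have "int k dvd f (c ! 0, c ! Suc 0) - f (c ! m, c ! 0) - 1"
  proof (rule circular_labelling_step[OF f])
    show "(c ! m, c ! 0) \<in> parcs G" using vwalk_arc_nth[OF L(3), of m] L m by simp
    show "(c ! 0, c ! Suc 0) \<in> parcs G" using vwalk_arc_nth[OF L(3), of 0] L by simp
    show "c ! m \<noteq> c ! Suc 0" using L(6)[of m "Suc 0"] m L(1) by simp
  qed
  ultimately have "int k dvd (f (c ! m, c ! 0) - f (c ! 0, c ! Suc 0) - int m) +
      (f (c ! 0, c ! Suc 0) - f (c ! m, c ! 0) - 1)"
    using L(5) m by (intro dvd_add) auto
  then have "int k dvd - int L" using m by (simp add: algebra_simps)
  then show ?thesis using L(4) by simp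
qed

text \<open>Since \<open>k\<close> divides its length, the cycle has at least \<open>k\<close> arcs,
  and the first \<open>k\<close> of them carry consecutive labels modulo \<open>k\<close>, hence all
  residues.\<close>

lemma circularly_partite_of_cycle:
  assumes k: "1 \<le> k" and f: "circular_labelling k G f" and c: "is_cycle G c"
  shows "circularly_partite k G"
proof (rule circularly_partiteI[OF k f])
  fix j
  let ?a = "f (c ! 0, c ! Suc 0)"
  \<comment> \<open>The number of arcs to advance from the first one, labelled \<open>?a\<close>,
    until the residue of \<open>j\<close> is reached.\<close>
  define i where "i = nat ((int j - ?a) mod int k)"
  have i: "int i = (int j - ?a) mod int k" using k by (simp add: i_def)
  have L: "3 \<le> vwalk_length c" "vwalk c (with_proj G)" using c by (auto simp: is_cycle_def)
  have "k \<le> vwalk_length c" using labelling_cycle_dvd[OF f c] L(1) by (intro dvd_imp_le) auto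
  moreover have "int i < int k" using k by (simp add: i)
  ultimately have il: "i < vwalk_length c" by simp
  then have "(c ! i, c ! Suc i) \<in> parcs G" by (intro vwalk_arc_nth[OF L(2)]) auto
  moreover have "int k dvd f (c ! i, c ! Suc i) - int j"
  proof -
    have "int k dvd f (c ! i, c ! Suc i) - ?a - int i" by (rule labelling_along_cycle[OF f c il])
    moreover have "int k dvd int i - (int j - ?a)"
      by (simp add: i flip: mod_eq_dvd_iff)
    ultimately have "int k dvd (f (c ! i, c ! Suc i) - ?a - int i) + (int i - (int j - ?a))"
      by (rule dvd_add)
    then show ?thesis by (simp add: algebra_simps)
  qed
  ultimately show "\<exists>e\<in>parcs G. int k dvd f e - int j" by blast
qed

text \<open>
  The degree matters for \<open>a = b\<close>: two further neighbours link the labels of \<open>(a, v)\<close> and \<open>(v, a)\<close>.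
\<close>

lemma labelling_at_branch:
  assumes f: "circular_labelling k G f" and v: "3 \<le> vdegree G v"
    and ab: "(v, a) \<in> parcs G" "(v, b) \<in> parcs G"
  shows "int k dvd f (v, b) - f (a, v) - 1"
proof (cases "a = b")
  case True
  obtain x y where xy: "(v, x) \<in> parcs G" "(v, y) \<in> parcs G" "x \<noteq> y" "x \<noteq> a" "y \<noteq> a"
    by (rule vdegree_ge_3E[OF v])
  have d: "int k dvd f (v, x) - f (a, v) - 1" "int k dvd f (v, x) - f (y, v) - 1"
    "int k dvd f (v, a) - f (y, v) - 1"
    using xy ab by (auto intro!: circular_labelling_step[OF f] dest: arc_sym)
  have "int k dvd (f (v, x) - f (a, v) - 1) - (f (v, x) - f (y, v) - 1) +
      (f (v, a) - f (y, v) - 1)"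
    by (rule dvd_add[OF dvd_diff[OF d(1,2)] d(3)])
  then show ?thesis using True by (simp add: algebra_simps)
next
  case False
  then show ?thesis using ab by (intro circular_labelling_step[OF f]) (auto dest: arc_sym)
qed

text \<open>A closed tour runs along the path, turns back at its end, returns and turns back at its
  start. By \<open>labelling_at_branch\<close> each turn also raises the label by 1, so the tour
  raises it by twice the length and yet closes.\<close>

lemma labelling_branch_path_dvd:
  assumes f: "circular_labelling k G f" and p: "is_path G p"
    and d: "3 \<le> vdegree G (hd p)" "3 \<le> vdegree G (last p)"
  shows "k dvd 2 * vwalk_length p"
proof -
  have w: "vwalk p (with_proj G)" "distinct p" "2 \<le> length p"
    using p by (auto simp: is_path_def vpath_def)
  obtain m where m: "length p = Suc (Suc m)"
    using w(3) by (metis add_2_eq_Suc le_Suc_ex)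
  have "p \<noteq> []" using m by auto
  then have ends: "hd p = p ! 0" "last p = p ! Suc m"
    using m by (simp_all add: hd_conv_nth last_conv_nth)
  have "int k dvd f (p ! m, p ! Suc m) - f (p ! 0, p ! Suc 0) - int m"
    using m w(2) by (intro labelling_along_walk[OF f w(1)]) (auto simp: nth_eq_iff_index_eq)
  moreover have "int k dvd f (rev p ! m, rev p ! Suc m) - f (rev p ! 0, rev p ! Suc 0) - int m"
    using m w(2) by (intro labelling_along_walk[OF f vwalk_rev[OF w(1)]])
      (auto simp: nth_eq_iff_index_eq)
  then have "int k dvd f (p ! Suc 0, p ! 0) - f (p ! Suc m, p ! m) - int m"
    using m by (simp add: rev_nth)
  moreover have "int k dvd f (p ! 0, p ! Suc 0) - f (p ! Suc 0, p ! 0) - 1"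
    using d(1) vwalk_arc_nth[OF w(1), of 0] m ends by (intro labelling_at_branch[OF f]) auto
  moreover have "int k dvd f (p ! Suc m, p ! m) - f (p ! m, p ! Suc m) - 1"
    using d(2) vwalk_arc_nth[OF w(1), of m] m ends
    by (intro labelling_at_branch[OF f]) (auto dest: arc_sym)
  \<comment> \<open>All labels cancel; each direction contributes \<open>m\<close> and each turn 1,
    where the length is \<open>Suc m\<close>.\<close>
  ultimately have "int k dvd
      (f (p ! m, p ! Suc m) - f (p ! 0, p ! Suc 0) - int m) +
      (f (p ! Suc 0, p ! 0) - f (p ! Suc m, p ! m) - int m) +
      (f (p ! 0, p ! Suc 0) - f (p ! Suc 0, p ! 0) - 1) +
      (f (p ! Suc m, p ! m) - f (p ! m, p ! Suc m) - 1)"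
    by (intro dvd_add)
  then have "int k dvd - int (2 * Suc m)" by (simp add: algebra_simps)
  then have "int k dvd int (2 * Suc m)" by (subst (asm) dvd_minus_iff)
  then have "k dvd 2 * Suc m" by (subst (asm) int_dvd_int_iff)
  then show ?thesis using m by simp
qed

end

section \<open>Labels from a height function\<close>

text \<open>A route that descends one level at a time from height \<open>a\<close> to 0 and climbs
  again carries the consecutive labels \<open>-a, ..., -1, 0, 1, ...\<close>.\<close>

definition height_label :: "('a \<Rightarrow> nat) \<Rightarrow> 'a \<times> 'a \<Rightarrow> int" where
  "height_label h e = (if h (snd e) < h (fst e) then - int (h (fst e)) else int (h (fst e)))"

text \<open>Arcs climbing one level carry \<open>0, ..., a - 1\<close> and their reversals
  \<open>-1, ..., -a\<close>; these \<open>2 * a\<close> consecutive integers cover all residues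
  when \<open>k \<le> 2 * a\<close>.\<close>

lemma (in pair_graph) circularly_partite_of_height:
  assumes k: "1 \<le> k" "k \<le> 2 * a" and f: "circular_labelling k G (height_label h)"
    and levels: "\<And>i. i < a \<Longrightarrow> \<exists>u w. (u, w) \<in> parcs G \<and> h u = i \<and> h w = Suc i"
  shows "circularly_partite k G"
proof (rule circularly_partiteI[OF k(1) f])
  fix j assume j: "j < k"
  show "\<exists>e\<in>parcs G. int k dvd height_label h e - int j"
  proof (cases "j < a")
    case True
    then obtain u w where "(u, w) \<in> parcs G" "h u = j" "h w = Suc j" using levels by blast
    then show ?thesis by (intro bexI[of _ "(u, w)"]) (auto simp: height_label_def)
  next
    case False
    \<comment> \<open>Here \<open>j\<close> is represented by the negative label
      \<open>- (k - j)\<close>, found on an arc descending from height \<open>k - j\<close>.\<close>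
    then have "k - j - 1 < a" using k j by linarith
    then obtain u w where "(u, w) \<in> parcs G" "h u = k - j - 1" "h w = Suc (k - j - 1)"
      using levels by blast
    then show ?thesis using j
      by (intro bexI[of _ "(w, u)"]) (auto simp: height_label_def of_nat_diff dest: arc_sym)
  qed
qed

text \<open>Take the position on the path as height. A non-backtracking walk keeps its direction, so
  labels rise by exactly 1 and the rule holds for every \<open>k\<close>; the bound
  \<open>2 * M\<close> comes from the number of labels available.\<close>

lemma (in pair_graph) path_graph_circularly_partite:
  assumes "is_path_graph G M" and k: "1 \<le> k" "k \<le> 2 * M"
  shows "circularly_partite k G"
proof -
  obtain p where p: "is_path G p" "vwalk_length p = M"
    and arcs: "parcs G = set (vwalk_arcs p) \<union> (set (vwalk_arcs p))\<inverse>"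
    using assms(1) unfolding is_path_graph_def by blast
  have d: "distinct p" "length p = Suc M" using p by (auto simp: is_path_def vpath_def)
  define h where "h v = (THE i. i < length p \<and> p ! i = v)" for v
  have h: "h (p ! i) = i" if "i < length p" for i
    unfolding h_def using that d(1) by (intro the_equality) (auto simp: nth_eq_iff_index_eq)
  have arc: "\<exists>i j. u = p ! i \<and> w = p ! j \<and> i \<le> M \<and> j \<le> M \<and> (j = Suc i \<or> i = Suc j)"
    if "(u, w) \<in> parcs G" for u w
    using that unfolding arcs set_vwalk_arcs_nth d(2) by fastforce
  have "circular_labelling k G (height_label h)"
    unfolding circular_labelling_def
  proof (intro allI impI)
    fix u w z assume a: "(u, w) \<in> parcs G" "(w, z) \<in> parcs G" "u \<noteq> z"
    obtain i j where 1: "u = p ! i" "w = p ! j" "i \<le> M" "j \<le> M" "j = Suc i \<or> i = Suc j"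
      using arc[OF a(1)] by blast
    obtain j' l where 2: "w = p ! j'" "z = p ! l" "j' \<le> M" "l \<le> M" "l = Suc j' \<or> j' = Suc l"
      using arc[OF a(2)] by blast
    have hs: "h u = i" "h w = j" "h z = l"
      using 1(1-4) 2(2,4) h d(2) by simp_all
    have "h w = j'" using 2(1,3) h d(2) by simp
    then have "j' = j" using hs by simp
    moreover have "i \<noteq> l" using a(3) 1(1) 2(2) by auto
    ultimately have "height_label h (w, z) - height_label h (u, w) - 1 = 0"
      using 1(5) 2(5) hs by (auto simp: height_label_def)
    then show "int k dvd height_label h (w, z) - height_label h (u, w) - 1" by simp
  qed
  moreover have "\<exists>u w. (u, w) \<in> parcs G \<and> h u = i \<and> h w = Suc i" if "i < M" for i
  proof -
    have "(p ! i, p ! Suc i) \<in> parcs G"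
      using p(1) that d by (auto simp: is_path_def vpath_def intro: vwalk_arc_nth)
    then show ?thesis using h that d(2) by (intro exI[of _ "p ! i"] exI[of _ "p ! Suc i"]) auto
  qed
  ultimately show ?thesis using circularly_partite_of_height k by blast
qed

section \<open>The distance from a root as height function\<close>

locale connected_pair_graph = pair_graph +
  assumes conn: "connected (with_proj G)"
begin

lemma reachable_verts:
  assumes "u \<in> pverts G" "v \<in> pverts G"
  shows "u \<rightarrow>\<^sup>*\<^bsub>with_proj G\<^esub> v"
proof -
  have "strongly_connected (with_proj G)"
    using symmetric_connected_imp_strongly_connected[OF pair_sym_arcs conn] .
  then show ?thesis using assms by auto
qed

lemma pverts_nonempty: "pverts G \<noteq> {}"
  using conn by (auto simp: connected_conv)

lemma geodesic:
  assumes "u \<in> pverts G" "v \<in> pverts G"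
  obtains p where "vpath p (with_proj G)" "hd p = u" "last p = v" "length p = Suc (vdist G u v)"
proof -
  have "\<exists>p. vpath p (with_proj G) \<and> hd p = u \<and> last p = v"
    using reachable_verts[OF assms] by (auto simp: reachable_vpath_conv)
  then have "\<exists>n p. vpath p (with_proj G) \<and> hd p = u \<and> last p = v \<and> vwalk_length p = n" by blast
  then have "\<exists>p. vpath p (with_proj G) \<and> hd p = u \<and> last p = v \<and> vwalk_length p = vdist G u v"
    unfolding vdist_def by (rule LeastI_ex)
  then obtain p where p: "vpath p (with_proj G)" "hd p = u" "last p = v"
    "vwalk_length p = vdist G u v" by blast
  moreover have "p \<noteq> []" using p(1) by auto
  ultimately show ?thesis using that[of p] by (cases p) auto
qed

lemma vdist_triangle:
  assumes "r \<in> pverts G" "u \<in> pverts G" "v \<in> pverts G"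
  shows "vdist G u v \<le> vdist G r u + vdist G r v"
proof -
  obtain p where p: "vpath p (with_proj G)" "hd p = r" "last p = u" "length p = Suc (vdist G r u)"
    using geodesic assms by metis
  obtain q where q: "vpath q (with_proj G)" "hd q = r" "last q = v" "length q = Suc (vdist G r v)"
    using geodesic assms by metis
  have ne: "p \<noteq> []" "q \<noteq> []" using p q by auto
  have pw: "vwalk (rev p) (with_proj G)" using p(1) by (auto intro: vwalk_rev)
  \<comment> \<open>The geodesics share \<open>r\<close>, so the second contributes only its tail to
    the concatenated walk; if that tail is empty, \<open>v\<close> is \<open>r\<close>.\<close>
  show ?thesis
  proof (cases "tl q = []")
    case True
    then have "v = r" using q ne by (metis last_ConsL list.exhaust_sel)
    then show ?thesis
      using vdist_le_vwalk[OF pw] p ne by (simp add: hd_rev last_rev)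
  next
    case False
    have qe: "q = r # tl q" using ne q(2) by (metis list.collapse)
    then have "vwalk (r # tl q) (with_proj G)" using q(1) by auto
    then have "(r, hd (tl q)) \<in> parcs G \<and> vwalk (tl q) (with_proj G)"
      using False by (auto elim: vwalk_consE)
    then have "vwalk (rev p @ tl q) (with_proj G)"
      using p ne by (intro vwalk_appendI pw) (auto simp: last_rev)
    from vdist_le_vwalk[OF this] show ?thesis
      using p q ne False by (simp add: hd_rev last_tl)
  qed
qed

end

locale rooted_pair_graph = connected_pair_graph +
  fixes r :: 'a
  assumes root: "r \<in> pverts G"
begin

abbreviation d :: "'a \<Rightarrow> nat" where "d \<equiv> vdist G r"

lemma d_root: "d r = 0"
  using vdist_le_vwalk[of "[r]"] root by simp

lemma d_arc_le:
  assumes "(u, w) \<in> parcs G"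
  shows "d w \<le> Suc (d u)"
proof -
  obtain p where p: "vpath p (with_proj G)" "hd p = r" "last p = u" "length p = Suc (d u)"
    using geodesic root in_arcsD1[OF assms] by metis
  have "vwalk (p @ [w]) (with_proj G)" using p assms by (intro vwalk_snocI) auto
  moreover have "p \<noteq> []" using p(1) by auto
  ultimately show ?thesis using vdist_le_vwalk[of "p @ [w]"] p by simp
qed

text \<open>The last vertex but one of a geodesic from \<open>r\<close> serves: the initial segment
  bounds its distance from above, \<open>d_arc_le\<close> from below.\<close>

lemma parent:
  assumes w: "w \<in> pverts G" "w \<noteq> r"
  obtains u where "(u, w) \<in> parcs G" "d w = Suc (d u)"
proof -
  obtain p where p: "vpath p (with_proj G)" "hd p = r" "last p = w" "length p = Suc (d w)"
    using geodesic root w(1) by metis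
  define q where "q = butlast p"
  have "p \<noteq> []" using p(1) by auto
  then have pq: "p = q @ [w]" using p(3) q_def by (metis append_butlast_last_id)
  have ne: "q \<noteq> []" using pq p(2) w(2) by auto
  have pw: "vwalk (q @ [w]) (with_proj G)" using p(1) pq by auto
  have arc: "(last q, w) \<in> parcs G"
    using pw ne by (auto simp: vwalk_def vwalk_arcs_append)
  have "vwalk q (with_proj G)" using vwalkI_append_l[OF ne pw] .
  from vdist_le_vwalk[OF this] have "d (last q) \<le> d w - 1" using p pq ne by simp
  moreover have "0 < d w" using p(4) pq ne by (metis length_append_singleton length_greater_0_conv nat.inject)
  ultimately have "Suc (d (last q)) \<le> d w" by simp
  then have "d w = Suc (d (last q))" using d_arc_le[OF arc] by simp
  then show ?thesis using that arc by blast
qed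

lemma d_levels:
  assumes "v \<in> pverts G" "i < d v"
  shows "\<exists>u w. (u, w) \<in> parcs G \<and> d u = i \<and> d w = Suc i"
  using assms
proof (induct "d v" arbitrary: v)
  case (Suc n)
  have "v \<noteq> r" using Suc.prems(2) d_root by auto
  then obtain u where u: "(u, v) \<in> parcs G" "d v = Suc (d u)" using parent Suc.prems(1) by blast
  show ?case
  proof (cases "i = d u")
    case False
    then show ?thesis using Suc.hyps(1)[of u] Suc.hyps(2) Suc.prems u in_arcsD1 by fastforce
  qed (use u in blast)
qed simp

text \<open>
  The path \<open>q\<close> joins two vertices at distance \<open>n\<close> from the root without coming closer to it.
  Extending both ends to parents keeps the quantity \<open>2 * n + vwalk_length q\<close> constant, and
  the extension ends with a cycle through the root or through a branch vertex.
\<close>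

lemma dvd_closing_path:
  assumes cyc: "\<And>c. is_cycle G c \<Longrightarrow> k dvd vwalk_length c"
    and branch: "\<And>w. w \<in> pverts G \<Longrightarrow> w \<noteq> r \<Longrightarrow> 3 \<le> vdegree G w \<Longrightarrow> k dvd 2 * d w"
  shows "vpath q (with_proj G) \<Longrightarrow> hd q \<noteq> last q \<Longrightarrow> d (hd q) = n \<Longrightarrow> d (last q) = n \<Longrightarrow>
    (\<And>x. x \<in> set q \<Longrightarrow> n \<le> d x) \<Longrightarrow> k dvd 2 * n + vwalk_length q"
proof (induct n arbitrary: q)
  case 0
  have qv: "q \<noteq> []" "set q \<subseteq> pverts G" using 0(1) by (auto simp: vpath_def vwalk_def)
  \<comment> \<open>Only the root has distance 0, so the ends cannot differ and the base case is
    vacuous.\<close>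
  have "x = r" if "x \<in> pverts G" "d x = 0" for x
    using parent[OF that(1)] that(2) by auto
  then have "hd q = r" "last q = r" using 0 qv by (simp_all add: subset_iff)
  then show ?case using 0 by simp
next
  case (Suc n)
  have qv: "q \<noteq> []" "set q \<subseteq> pverts G" "vwalk q (with_proj G)" "distinct q"
    using Suc.prems(1) by (auto simp: vpath_def vwalk_def)
  have len: "2 \<le> length q" using Suc.prems(2) qv(1) by (cases q) (auto simp: Suc_le_eq)
  have v: "hd q \<in> pverts G" "last q \<in> pverts G" using qv by auto
  have nr: "hd q \<noteq> r" "last q \<noteq> r" using Suc.prems(3,4) d_root by auto
  obtain u where u: "(u, hd q) \<in> parcs G" "d (hd q) = Suc (d u)" by (rule parent[OF v(1) nr(1)])
  obtain w where w: "(w, last q) \<in> parcs G" "d (last q) = Suc (d w)" by (rule parent[OF v(2) nr(2)])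
  have du: "d u = n" "d w = n" using u w Suc.prems by auto
  have nin: "u \<notin> set q" "w \<notin> set q" using Suc.prems(5) du by fastforce+
  have walk: "vwalk (u # q @ [w]) (with_proj G)"
    using qv u w by (intro vwalk_ConsI vwalk_snocI) (auto simp: arc_sym)
  show ?case
  proof (cases "u = w")
    case True
    have "is_cycle G (u # q @ [u])"
      using walk True nin qv len by (auto simp: is_cycle_def)
    then have c: "k dvd Suc (length q)" using cyc by fastforce
    have "k dvd 2 * n"
    proof (cases "u = r")
      case True
      then show ?thesis using du d_root by simp
    next
      case False
      obtain x where x: "(x, u) \<in> parcs G" "d u = Suc (d x)"
        using parent False in_arcsD1[OF u(1)] by blast
      \<comment> \<open>The parent \<open>x\<close>, one level nearer the root, and the two distinct
        ends of \<open>q\<close>, one level further away, make \<open>u\<close> a branch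
        vertex.\<close>
      have "3 \<le> vdegree G u"
      proof (rule vdegree_ge_3I)
        show "(u, x) \<in> parcs G" using x by (simp add: arc_sym)
        show "(u, hd q) \<in> parcs G" "(u, last q) \<in> parcs G" using u w True by auto
        show "x \<noteq> hd q" "x \<noteq> last q" using x u w du by auto
      qed (rule Suc.prems(2))
      then show ?thesis using branch False in_arcsD1[OF u(1)] du by blast
    qed
    then have "k dvd 2 * n + Suc (length q)" using c by (rule dvd_add)
    moreover have "2 * n + Suc (length q) = 2 * Suc n + vwalk_length q" using len by simp
    ultimately show ?thesis by (simp only:)
  next
    case False
    have "k dvd 2 * n + vwalk_length (u # q @ [w])"
    proof (rule Suc.hyps)
      show "vpath (u # q @ [w]) (with_proj G)"
        using walk nin qv False by (auto simp: vpath_def)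
      show "n \<le> d x" if "x \<in> set (u # q @ [w])" for x
        using that Suc.prems(5)[of x] du by auto
    qed (use False du in auto)
    moreover have "2 * n + vwalk_length (u # q @ [w]) = 2 * Suc n + vwalk_length q"
      using len by simp
    ultimately show ?thesis by (simp only:)
  qed
qed

lemma circular_labelling_height:
  assumes cyc: "\<And>c. is_cycle G c \<Longrightarrow> k dvd vwalk_length c"
    and branch: "\<And>w. w \<in> pverts G \<Longrightarrow> w \<noteq> r \<Longrightarrow> 3 \<le> vdegree G w \<Longrightarrow> k dvd 2 * d w"
  shows "circular_labelling k G (height_label d)"
  unfolding circular_labelling_def
proof (intro allI impI)
  fix u w z assume uw: "(u, w) \<in> parcs G" and wz: "(w, z) \<in> parcs G" and ne: "u \<noteq> z"
  note closing = dvd_closing_path[OF cyc branch]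
  have dd: "d u \<le> Suc (d w)" "d w \<le> Suc (d u)" "d z \<le> Suc (d w)" "d w \<le> Suc (d z)"
    using uw wz by (auto intro: d_arc_le arc_sym)
  have vs: "u \<in> pverts G" "w \<in> pverts G" "z \<in> pverts G" using uw wz wellformed' by auto
  \<comment> \<open>An arc within a level is itself a path of length 1 joining two vertices at equal
    distance.\<close>
  have same_level: "k dvd 2 * d x + 1" if "(x, y) \<in> parcs G" "d x = d y" for x y
  proof -
    have "k dvd 2 * d x + vwalk_length [x, y]"
      using that arc_neq[OF that(1)] in_arcsD1[OF that(1)] in_arcsD2[OF that(1)]
      by (intro closing) (auto simp: vpath_def vwalk_def)
    then show ?thesis by simp
  qed
  \<comment> \<open>If neither \<open>u\<close> nor \<open>z\<close> is closer to the root than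
    \<open>w\<close>, the parent of \<open>w\<close> is a third neighbour and \<open>w\<close> is a
    branch vertex, unless it is the root.\<close>
  have no_parent: "k dvd 2 * d w" if "d w \<le> d u" "d w \<le> d z"
  proof (cases "w = r")
    case False
    then obtain x where x: "(x, w) \<in> parcs G" "d w = Suc (d x)" using parent vs by blast
    have "3 \<le> vdegree G w"
      by (rule vdegree_ge_3I[of _ x u z]) (use x uw wz ne that arc_sym in auto)
    then show ?thesis using branch False vs by blast
  qed (simp add: d_root)
  have to_int: "int k dvd 2 * int n" if "k dvd 2 * n" for n
    using that int_dvd_int_iff[of k "2 * n"] by simp
  have to_int': "int k dvd 2 * int n + 1" if "k dvd 2 * n + 1" for n
    using that int_dvd_int_iff[of k "2 * n + 1"] by (simp add: add.commute)
  \<comment> \<open>The names tell how each arc moves: \<open>down\<close> away from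
    \<open>r\<close>, \<open>up\<close> towards it, \<open>same\<close> within a level. As second
    arc, \<open>down\<close> includes staying level, since its label depends only on whether the
    distance drops.\<close>
  consider (down_down) "d u < d w" "d w \<le> d z" | (down_up) "d u < d w" "d z < d w"
    | (same_up) "d u = d w" "d z < d w" | (same_down) "d u = d w" "d w \<le> d z"
    | (up_up) "d w < d u" "d z < d w" | (up_down) "d w < d u" "d w \<le> d z"
    by linarith
  then show "int k dvd height_label d (w, z) - height_label d (u, w) - 1"
  proof cases
    case down_down
    then have "height_label d (w, z) - height_label d (u, w) - 1 = 0"
      using dd by (simp add: height_label_def)
    then show ?thesis by simp
  next
    case down_up
    then have "d u = d w - 1" "d z = d w - 1" "1 \<le> d w" using dd by auto
    \<comment> \<open>Two parents of \<open>w\<close> are joined through \<open>w\<close> by a path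
      of length 2 that stays at distance \<open>d w - 1\<close> or more.\<close>
    then have "k dvd 2 * (d w - 1) + vwalk_length [u, w, z]"
      using uw wz ne vs arc_neq[OF uw] arc_neq[OF wz]
      by (intro closing) (auto simp: vpath_def vwalk_def)
    moreover have "2 * (d w - 1) + vwalk_length [u, w, z] = 2 * d w" using \<open>1 \<le> d w\<close> by simp
    ultimately have "k dvd 2 * d w" by (simp only:)
    moreover have "height_label d (w, z) - height_label d (u, w) - 1 = - (2 * int (d w))"
      using down_up dd by (simp add: height_label_def)
    ultimately show ?thesis using to_int by simp
  next
    case same_up
    then have "height_label d (w, z) - height_label d (u, w) - 1 = - (2 * int (d w) + 1)"
      by (simp add: height_label_def)
    then show ?thesis using to_int'[OF same_level[OF uw]] same_up dvd_minus_iff by metis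
  next
    case same_down
    \<comment> \<open>The defect is -1 here, so \<open>k\<close> must be 1; this follows because it
      divides two consecutive numbers.\<close>
    then have "k dvd 2 * d w" using no_parent by simp
    moreover have "k dvd 2 * d w + 1" using same_level[OF uw] same_down by simp
    ultimately have "k = 1" by (metis dvd_add_right_iff nat_dvd_1_iff_1)
    then show ?thesis by simp
  next
    case up_up
    then have "height_label d (w, z) - height_label d (u, w) - 1 = 0"
      using dd by (simp add: height_label_def)
    then show ?thesis by simp
  next
    case up_down
    then have "height_label d (w, z) - height_label d (u, w) - 1 = 2 * int (d w)"
      using dd by (simp add: height_label_def)
    then show ?thesis using to_int no_parent up_down by simp
  qed
qed

lemma circularly_partite_of_distance:
  assumes "circular_labelling k G (height_label d)" and "v \<in> pverts G" "1 \<le> k" "k \<le> 2 * d v"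
  shows "circularly_partite k G"
  using circularly_partite_of_height[OF assms(3,4,1)] d_levels[OF assms(2)] by blast

end

section \<open>Extended stars and graphs without branch vertices\<close>

context connected_pair_graph
begin

text \<open>Rooted at the only branch vertex of a tree, both divisibility conditions are vacuous, so
  the distance labelling works for every \<open>k\<close>. Of two vertices realising the diameter,
  one lies at least half of it away from the root, which supplies enough labels.\<close>

lemma extended_star_circularly_partite:
  assumes star: "is_extended_star G" and k: "1 \<le> k" "k \<le> diameter G"
  shows "circularly_partite k G"
proof -
  obtain r where r: "r \<in> pverts G" and uniq: "\<And>v. v \<in> pverts G \<Longrightarrow> 3 \<le> vdegree G v \<Longrightarrow> v = r"
    and acyc: "\<And>c. \<not> is_cycle G c"
    using star unfolding is_extended_star_def is_tree_def by auto
  interpret rooted_pair_graph G r by unfold_locales (rule r)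
  have lab: "circular_labelling k G (height_label d)"
    by (rule circular_labelling_height) (use uniq acyc in auto)
  let ?D = "{vdist G u v | u v. u \<in> pverts G \<and> v \<in> pverts G}"
  have "?D = (\<lambda>(u, v). vdist G u v) ` (pverts G \<times> pverts G)" by auto
  then have "finite ?D" using pair_finite_verts by simp
  moreover have "?D \<noteq> {}" using r by auto
  ultimately have "diameter G \<in> ?D" unfolding diameter_def by (rule Max_in)
  then obtain u v where uv: "diameter G = vdist G u v" "u \<in> pverts G" "v \<in> pverts G" by blast
  then have "k \<le> d u + d v" using vdist_triangle[OF r, of u v] k by simp
  then have "k \<le> 2 * d u \<or> k \<le> 2 * d v" by linarith
  then show ?thesis using circularly_partite_of_distance[OF lab] uv k by blast
qed

end

section \<open>Acyclic graphs without branch vertices are path graphs\<close>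

context pair_graph
begin

text \<open>A neighbour of the end outside the path would extend it, and one further along the path
  would close a cycle.\<close>

lemma longest_path_end_neighbour:
  assumes p: "vpath p (with_proj G)" "2 \<le> length p"
    and longest: "\<And>q. vpath q (with_proj G) \<Longrightarrow> length q \<le> length p"
    and acyc: "\<And>c. \<not> is_cycle G c" and y: "(p ! 0, y) \<in> parcs G"
  shows "y = p ! 1"
proof -
  have w: "vwalk p (with_proj G)" "distinct p" "p \<noteq> []" "hd p = p ! 0"
    using p by (auto simp: vpath_def hd_conv_nth)
  have "y \<in> set p"
  proof (rule ccontr)
    assume "y \<notin> set p"
    moreover have "vwalk (y # p) (with_proj G)"
      using w arc_sym[OF y] by (intro vwalk_ConsI) simp_all
    ultimately have "vpath (y # p) (with_proj G)" using w(2) by (simp add: vpath_def)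
    then show False using longest[of "y # p"] by simp
  qed
  then obtain j where j: "j < length p" "y = p ! j" by (auto simp: in_set_conv_nth)
  have "j \<noteq> 0" using j arc_neq[OF y] by metis
  moreover have "\<not> 2 \<le> j"
  proof
    assume j2: "2 \<le> j"
    \<comment> \<open>The segment from the end to \<open>y\<close>, closed by the arc back;
      \<open>2 \<le> j\<close> gives it at least three arcs.\<close>
    let ?t = "take (Suc j) p"
    have t: "?t \<noteq> []" "hd ?t = p ! 0" "last ?t = y" "length ?t = Suc j"
      using j w(3,4) by (auto simp: last_conv_nth)
    have "vwalk (?t @ drop (Suc j) p) (with_proj G)" using w(1) by simp
    then have "vwalk ?t (with_proj G)" by (rule vwalkI_append_l[OF t(1)])
    then have "vwalk (?t @ [p ! 0]) (with_proj G)"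
      using t y by (intro vwalk_snocI) (auto simp: arc_sym)
    then have "is_cycle G (?t @ [p ! 0])"
      using t j2 w(2) unfolding is_cycle_def by (simp add: butlast_append hd_append)
    then show False using acyc by blast
  qed
  ultimately show ?thesis using j(2) by (cases "j = 1") auto
qed

end

text \<open>Take a longest path. Inner vertices have no third neighbour and the ends none beyond
  their single path neighbour, so the path is closed under adjacency and by connectedness is the
  whole graph. The arc ensures length at least 1.\<close>

lemma (in connected_pair_graph) path_graph_of_degree_le_2:
  assumes arcs: "parcs G \<noteq> {}" and acyc: "\<And>c. \<not> is_cycle G c"
    and deg: "\<And>v. v \<in> pverts G \<Longrightarrow> \<not> 3 \<le> vdegree G v"
  shows "\<exists>M. is_path_graph G M"
proof -
  obtain a b where ab: "(a, b) \<in> parcs G" using arcs by auto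
  have bound: "length q < Suc (card (pverts G))" if "vpath q (with_proj G)" for q
  proof -
    have "set q \<subseteq> pverts G" "distinct q" using that by (auto simp: vpath_def vwalk_def)
    then show ?thesis
      using card_mono[OF pair_finite_verts] by (metis distinct_card less_Suc_eq_le)
  qed
  have ab_path: "vpath [a, b] (with_proj G)"
    using ab arc_neq in_arcsD1[OF ab] in_arcsD2[OF ab] by (auto simp: vpath_def vwalk_def)
  then obtain p where p: "vpath p (with_proj G)"
    and longest: "\<And>q. vpath q (with_proj G) \<Longrightarrow> length q \<le> length p"
    using ex_has_greatest_nat[of "\<lambda>q. vpath q (with_proj G)" _ length] bound by blast
  have len: "2 \<le> length p" using longest[OF ab_path] by simp
  have w: "vwalk p (with_proj G)" "distinct p" "set p \<subseteq> pverts G"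
    using p by (auto simp: vpath_def vwalk_def)
  have rp: "vpath (rev p) (with_proj G)" using w by (auto intro: vwalk_rev)
  have nbr: "\<exists>j < length p. y = p ! j \<and> (j = Suc i \<or> i = Suc j)"
    if i: "i < length p" and y: "(p ! i, y) \<in> parcs G" for i y
  proof -
    consider "i = 0" | "Suc i = length p" | "0 < i" "Suc i < length p" using i by linarith
    then show ?thesis
    proof cases
      case 1
      then have "y = p ! 1" using longest_path_end_neighbour[OF p len longest acyc] y by simp
      then show ?thesis using 1 len by (intro exI[of _ 1]) auto
    next
      case 2
      \<comment> \<open>The reversed path is a longest one too, so the other end follows by
        symmetry.\<close>
      then have "rev p ! 0 = p ! i" using i by (simp add: rev_nth flip: 2)
      then have "y = rev p ! 1"
        using longest_path_end_neighbour[OF rp _ _ acyc] len longest y by simp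
      then have "y = p ! (i - 1)" using len by (simp add: rev_nth flip: 2)
      then show ?thesis using 2 len by (intro exI[of _ "i - 1"]) auto
    next
      case 3
      then have l: "(p ! i, p ! (i - 1)) \<in> parcs G"
        using vwalk_arc_nth[OF w(1), of "i - 1"] by (auto intro: arc_sym)
      have r: "(p ! i, p ! Suc i) \<in> parcs G" using 3 vwalk_arc_nth[OF w(1)] by simp
      have "p ! (i - 1) \<noteq> p ! Suc i" using 3 w(2) by (simp add: nth_eq_iff_index_eq)
      moreover have "\<not> 3 \<le> vdegree G (p ! i)" using deg w(3) i by (simp add: subset_iff)
      ultimately have "y = p ! (i - 1) \<or> y = p ! Suc i"
        using vdegree_ge_3I[OF l r y] by blast
      then show ?thesis
      proof
        assume "y = p ! (i - 1)"
        then show ?thesis using 3 by (intro exI[of _ "i - 1"]) auto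
      next
        assume "y = p ! Suc i"
        then show ?thesis using 3 by (intro exI[of _ "Suc i"]) auto
      qed
    qed
  qed
  have "v \<in> set p" if "v \<in> pverts G" for v
  proof -
    have "hd p \<in> pverts G" "hd p \<in> set p" using w by (auto simp: vwalk_def)
    then have "hd p \<rightarrow>\<^sup>*\<^bsub>with_proj G\<^esub> v" using reachable_verts that by blast
    then show ?thesis
    proof (induct rule: reachable_induct)
      case base
      show ?case by fact
    next
      case (step x y)
      then obtain i where "i < length p" "x = p ! i" by (auto simp: in_set_conv_nth)
      then show ?case using nbr[of i y] step by auto
    qed
  qed
  then have verts: "pverts G = set p" using w(3) by blast
  have "parcs G = set (vwalk_arcs p) \<union> (set (vwalk_arcs p))\<inverse>"
  proof
    show "parcs G \<subseteq> set (vwalk_arcs p) \<union> (set (vwalk_arcs p))\<inverse>"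
    proof
      fix e assume e: "e \<in> parcs G"
      obtain x y where xy: "e = (x, y)" by (cases e)
      then have "x \<in> set p" using e verts in_arcsD1 by blast
      then obtain i where i: "i < length p" "x = p ! i" by (auto simp: in_set_conv_nth)
      then obtain j where "j < length p" "y = p ! j" "j = Suc i \<or> i = Suc j"
        using nbr[of i y] e xy by blast
      then show "e \<in> set (vwalk_arcs p) \<union> (set (vwalk_arcs p))\<inverse>"
        using i xy unfolding set_vwalk_arcs_nth by auto
    qed
    have "set (vwalk_arcs p) \<subseteq> parcs G" using w(1) by (auto simp: vwalk_def)
    then show "set (vwalk_arcs p) \<union> (set (vwalk_arcs p))\<inverse> \<subseteq> parcs G" by (auto intro: arc_sym)
  qed
  then have "is_path_graph G (vwalk_length p)"
    unfolding is_path_graph_def using p len verts by (auto simp: is_path_def)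
  then show ?thesis by blast
qed

section \<open>The characterisation\<close>

text \<open>The two conditions make the distance labelling valid; the excluded shapes matter for
  hitting every residue. A cycle does so by itself, and an acyclic graph outside both families has
  two branch vertices, far enough apart by divisibility.\<close>

lemma (in connected_pair_graph) circularly_partite_if:
  assumes k: "1 \<le> k" and arcs: "parcs G \<noteq> {}"
    and no_path: "\<not> (\<exists>M. is_path_graph G M)" and no_star: "\<not> is_extended_star G"
    and cyc: "\<And>c. is_cycle G c \<Longrightarrow> k dvd vwalk_length c"
    and paths: "\<And>p. is_path G p \<Longrightarrow> hd p \<noteq> last p \<Longrightarrow> 3 \<le> vdegree G (hd p) \<Longrightarrow>
      3 \<le> vdegree G (last p) \<Longrightarrow> k dvd 2 * vwalk_length p"
  shows "circularly_partite k G"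
proof -
  \<comment> \<open>The implication lets any vertex be the root when there is no branch
    vertex.\<close>
  have "\<exists>r\<in>pverts G. (\<exists>v\<in>pverts G. 3 \<le> vdegree G v) \<longrightarrow> 3 \<le> vdegree G r"
    using pverts_nonempty by blast
  then obtain r where r: "r \<in> pverts G"
    and rb: "\<And>v. v \<in> pverts G \<Longrightarrow> 3 \<le> vdegree G v \<Longrightarrow> 3 \<le> vdegree G r" by blast
  interpret rooted_pair_graph G r by unfold_locales (rule r)
  have branch: "k dvd 2 * d w" "0 < d w"
    if w: "w \<in> pverts G" "w \<noteq> r" "3 \<le> vdegree G w" for w
  proof -
    obtain p where p: "vpath p (with_proj G)" "hd p = r" "last p = w" "length p = Suc (d w)"
      using geodesic r w(1) by metis
    show "0 < d w" by (rule parent[OF w(1,2)]) simp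
    then have "is_path G p" using p by (auto simp: is_path_def)
    then have "k dvd 2 * vwalk_length p" using paths p w rb by metis
    then show "k dvd 2 * d w" using p by simp
  qed
  have lab: "circular_labelling k G (height_label d)"
    using circular_labelling_height cyc branch by blast
  show ?thesis
  proof (cases "\<exists>c. is_cycle G c")
    case True
    then show ?thesis using circularly_partite_of_cycle[OF k lab] by blast
  next
    case False
    \<comment> \<open>Not being a path graph yields one branch vertex, so \<open>r\<close> is one;
      not being an extended star then yields a second, \<open>w\<close>. As \<open>k\<close> divides
      the positive number \<open>2 * d w\<close>, it is at most that number.\<close>
    have "\<exists>v\<in>pverts G. 3 \<le> vdegree G v" using path_graph_of_degree_le_2 arcs False no_path by blast
    then have "3 \<le> vdegree G r" using rb by blast
    moreover have "\<not> (\<exists>!v. v \<in> pverts G \<and> 3 \<le> vdegree G v)"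
      using no_star False conn unfolding is_extended_star_def is_tree_def by blast
    ultimately obtain w where w: "w \<in> pverts G" "w \<noteq> r" "3 \<le> vdegree G w" using r by blast
    have "k \<le> 2 * d w" using branch[OF w] by (intro dvd_imp_le) auto
    then show ?thesis using circularly_partite_of_distance[OF lab w(1) k] by blast
  qed
qed

theorem theorem2p3:
  fixes G :: "'a pair_pre_digraph"
  assumes "pair_graph G" and "connected (with_proj G)"
  shows "(\<forall>M. is_path_graph G M \<longrightarrow> (\<forall>k\<in>{1..2 * M}. circularly_partite k G)) \<and>
    (\<forall>M. is_extended_star G \<and> diameter G = M \<longrightarrow> (\<forall>k\<in>{1..M}. circularly_partite k G)) \<and>
    (\<forall>k\<ge>1. parcs G \<noteq> {} \<and> \<not> (\<exists>M. is_path_graph G M) \<and> \<not> is_extended_star G \<longrightarrow>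
      (circularly_partite k G \<longleftrightarrow>
        (\<forall>c. is_cycle G c \<longrightarrow> k dvd vwalk_length c) \<and>
        (\<forall>p. is_path G p \<and> hd p \<noteq> last p \<and> 3 \<le> vdegree G (hd p) \<and> 3 \<le> vdegree G (last p) \<longrightarrow>
           k dvd 2 * vwalk_length p)))"
proof -
  interpret pair_graph G by fact
  interpret connected_pair_graph G by unfold_locales fact
  have "\<forall>M. is_path_graph G M \<longrightarrow> (\<forall>k\<in>{1..2 * M}. circularly_partite k G)"
    using path_graph_circularly_partite by auto
  moreover have "\<forall>M. is_extended_star G \<and> diameter G = M \<longrightarrow> (\<forall>k\<in>{1..M}. circularly_partite k G)"
    using extended_star_circularly_partite by auto
  moreover have "circularly_partite k G \<longleftrightarrow>
        (\<forall>c. is_cycle G c \<longrightarrow> k dvd vwalk_length c) \<and>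
        (\<forall>p. is_path G p \<and> hd p \<noteq> last p \<and> 3 \<le> vdegree G (hd p) \<and> 3 \<le> vdegree G (last p) \<longrightarrow>
           k dvd 2 * vwalk_length p)"
    if "1 \<le> k" "parcs G \<noteq> {}" "\<not> (\<exists>M. is_path_graph G M)" "\<not> is_extended_star G" for k
  proof (intro iffI conjI allI impI)
    assume "circularly_partite k G"
    then obtain f where f: "circular_labelling k G f" by (rule circularly_partite_labelling)
    show "k dvd vwalk_length c" if "is_cycle G c" for c
      by (rule labelling_cycle_dvd[OF f that])
    show "k dvd 2 * vwalk_length p" if "is_path G p \<and> hd p \<noteq> last p \<and>
        3 \<le> vdegree G (hd p) \<and> 3 \<le> vdegree G (last p)" for p
      using labelling_branch_path_dvd[OF f] that by blast
  qed (use circularly_partite_if[OF that] in blast)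
  ultimately show ?thesis by blast
qed

end
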